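(* Let $N$ be a non-negative integer. For every $n\ge N+1$, $$h_n^{\alpha,\beta}(x;N)=(x-N)_{N+1}\,(-i)^{n-N-1}\,p_{n-N-1}(ix;\,N+1,\ \beta+N+1,\ 1,\ \alpha+1)$$ $$=(x-N)_{N+1}\,(-i)^{n-N-1}\,p_{n-N-1}\!\left(\left(x-\tfrac N2\right)i;\ 1+\tfrac N2,\ \beta+1+\tfrac N2,\ 1+\tfrac N2,\ \alpha+1+\tfrac N2\right).$$
   Context: $(a)_0=1$, $(a)_n=a(a+1)\cdots(a+n-1)$; $i$ is the imaginary unit; $\alpha,\beta$ are complex parameters. Monic Hahn polynomials for all degrees $n\ge0$ are defined by $$h_n^{\alpha,\beta}(x;N)=\frac{(\alpha+1)_n}{(\alpha+\beta+n+1)_n}\sum_{k=0}^n\frac{(-n)_k(\alpha+\beta+n+1)_k(-x)_k\,(-N+k)_{n-k}}{(\alpha+1)_k\,k!},$$ where $(\alpha+1)_n/(\alpha+1)_k$ and $(\alpha+\beta+n+1)_k/(\alpha+\beta+n+1)_n$ are read as $(\alpha+1+k)_{n-k}$ and $1/(\alpha+\beta+n+k+1)_{n-k}$. Monic continuous Hahn polynomials are $$p_m(x;a,b,c,d)=\frac{i^m(a+c)_m(a+d)_m}{(m+a+b+c+d-1)_m}\;{}_3F_2\!\left(\begin{array}{c}-m,\ m+a+b+c+d-1,\ a+ix\\ a+c,\ a+d\end{array}\Big|\,1\right),$$ with quotients of Pochhammer symbols simplified termwise in the same way. Restrictions on $\alpha,\beta$ coming from vanishing denominators are only a matter of the monic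 normalization; they disappear under a suitable normalization (for instance one with polynomial dependence on the parameters). *)

theory Defs
  imports Complex_Main
begin

(* The quotients of shifted factorials in the usual definitions are cancelled termwise, using
     (a)_n / (a)_k = (a + k)_{n-k}   for k \<le> n.
   Hence only the shifted factorials coming from the monic normalization remain as denominators,
   and parameters with (alpha + 1)_k = 0, (a + c)_k = 0 or (a + d)_k = 0 need not be excluded. *)

(* Uncancelled:
     (alpha+1)_n / (alpha+beta+n+1)_n *
       Sum_{k=0..n} (-n)_k (alpha+beta+n+1)_k (-x)_k (-N+k)_{n-k} / ((alpha+1)_k k!).
   The degree n is not restricted to n \<le> N. *)
definition monic_hahn :: "nat \<Rightarrow> complex \<Rightarrow> complex \<Rightarrow> nat \<Rightarrow> complex \<Rightarrow> complex" where
  "monic_hahn n \<alpha> \<beta> N x =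
     (\<Sum>k=0..n.
        pochhammer (- of_nat n) k * pochhammer (- x) k
        * pochhammer (- of_nat N + of_nat k) (n - k)
        * pochhammer (\<alpha> + 1 + of_nat k) (n - k)
        / (pochhammer (\<alpha> + \<beta> + of_nat n + of_nat k + 1) (n - k) * fact k))"

(* Uncancelled:
     i^m (a+c)_m (a+d)_m / (m+a+b+c+d-1)_m *
       3F2(-m, m+a+b+c+d-1, a+ix; a+c, a+d; 1),
   the hypergeometric series terminating at k = m. *)
definition monic_continuous_hahn ::
  "nat \<Rightarrow> complex \<Rightarrow> complex \<Rightarrow> complex \<Rightarrow> complex \<Rightarrow> complex \<Rightarrow> complex" where
  "monic_continuous_hahn m x a b c d =
     \<i> ^ m *
     (\<Sum>k=0..m.
        pochhammer (- of_nat m) k * pochhammer (a + \<i> * x) k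
        * pochhammer (a + c + of_nat k) (m - k)
        * pochhammer (a + d + of_nat k) (m - k)
        / (pochhammer (of_nat m + a + b + c + d - 1 + of_nat k) (m - k) * fact k))"

end

(* The factor (-N+k)_{n-k} kills the terms of the Hahn sum with k \<le> N. After the shift
   k = N + 1 + j the remaining ones agree one by one with the terms of the continuous Hahn sum.
   The two continuous Hahn polynomials coincide because the series depends only on
   a + ix, a + c, a + d and a + b + c + d. *)
theory Submission
  imports Defs
begin

text \<open>Split m! = (1)_m after j factors. It evaluates the two symbols with integer base:
  (-N+k)_{n-k} in the Hahn sum and (a+c+j)_{m-j} in the continuous one.\<close>

lemma pochhammer_of_nat_Suc_eq_fact_quotient:
  assumes "j \<le> m"
  shows "pochhammer (of_nat (Suc j)) (m - j) = (fact m / fact j :: 'a :: field_char_0)"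
proof -
  have "fact m = pochhammer (1::'a) (j + (m - j))"
    using assms by (simp add: pochhammer_fact)
  also have "\<dots> = fact j * pochhammer (of_nat (Suc j)) (m - j)"
    by (simp add: pochhammer_product'[of 1 j] pochhammer_fact del: le_add_diff_inverse)
  finally show ?thesis by simp
qed

text \<open>The first l factors, negated and reversed, are (m+1)_l; the remaining ones start at -m.
  Used with l = N+1.\<close>

lemma pochhammer_uminus_of_nat_shift:
  "pochhammer (- of_nat (m + l)) (l + j) =
     ((-1) ^ l * (fact (m + l) / fact m) * pochhammer (- of_nat m) j :: 'a :: field_char_0)"
proof -
  have "pochhammer (- of_nat (m + l) :: 'a) l = (-1) ^ l * pochhammer (of_nat (Suc m)) l"
    by (subst pochhammer_minus) (simp add: add.commute)
  moreover have "pochhammer (of_nat (Suc m)) l = (fact (m + l) / fact m :: 'a)"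
    using pochhammer_of_nat_Suc_eq_fact_quotient[of m "m + l"] by simp
  ultimately show ?thesis by (simp add: pochhammer_product')
qed

text \<open>The source of the prefactor (x-N)_{N+1}: negating and reversing the first N+1 factors
  gives it, and the remainder starts at N+1-x.\<close>

lemma pochhammer_minus_Suc_shift:
  fixes x :: "'a :: comm_ring_1"
  shows "pochhammer (- x) (Suc N + j) =
     (-1) ^ Suc N * pochhammer (x - of_nat N) (Suc N) * pochhammer (of_nat N + 1 - x) j"
proof -
  have "pochhammer (- x) (Suc N) = (-1) ^ Suc N * pochhammer (x - of_nat N) (Suc N)"
    by (subst pochhammer_minus) (simp add: algebra_simps)
  moreover have "pochhammer (- x + of_nat (Suc N)) j = pochhammer (of_nat N + 1 - x) j"
    by (simp add: algebra_simps)
  ultimately show ?thesis by (simp only: pochhammer_product')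
qed

lemma monic_hahn_eq_monic_continuous_hahn:
  "monic_hahn (m + Suc N) \<alpha> \<beta> N x =
     pochhammer (x - of_nat N) (Suc N) * (- \<i>) ^ m
     * monic_continuous_hahn m (\<i> * x) (of_nat N + 1) (\<beta> + of_nat N + 1) 1 (\<alpha> + 1)"
proof -
  define f where "f k =
      pochhammer (- of_nat (m + Suc N)) k * pochhammer (- x) k
      * pochhammer (- of_nat N + of_nat k) (m + Suc N - k)
      * pochhammer (\<alpha> + 1 + of_nat k) (m + Suc N - k)
      / (pochhammer (\<alpha> + \<beta> + of_nat (m + Suc N) + of_nat k + 1) (m + Suc N - k) * fact k)"
    for k :: nat
  \<comment> \<open>The continuous Hahn summand for a = N+1, b = \<beta>+N+1, c = 1, d = \<alpha>+1,
    with a + i(ix) written as N+1-x.\<close>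
  define g where "g j =
      pochhammer (- of_nat m) j * pochhammer (of_nat N + 1 - x) j
      * pochhammer (of_nat N + 1 + 1 + of_nat j) (m - j)
      * pochhammer (of_nat N + 1 + (\<alpha> + 1) + of_nat j) (m - j)
      / (pochhammer (of_nat m + (of_nat N + 1) + (\<beta> + of_nat N + 1) + 1 + (\<alpha> + 1) - 1
           + of_nat j) (m - j) * fact j)"
    for j :: nat
  have f_zero: "f k = 0" if "k \<le> N" for k
  proof -
    have "- of_nat N + of_nat k = (- of_nat (N - k) :: complex)"
      using that by (simp add: of_nat_diff)
    \<comment> \<open>Starting from -(N-k), the factor 0 appears after N-k steps, and there are more
      than N-k factors.\<close>
    moreover have "pochhammer (- of_nat (N - k) :: complex) (m + Suc N - k) = 0"
      using that by (intro pochhammer_of_nat_eq_0_lemma) simp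
    ultimately show ?thesis unfolding f_def by simp
  qed
  have f_shift: "f (Suc N + j) = pochhammer (x - of_nat N) (Suc N) * g j" if "j \<le> m" for j
  proof -
    have len: "m + Suc N - (Suc N + j) = m - j" by simp
    have base1: "- of_nat N + of_nat (Suc N + j) = (of_nat (Suc j) :: complex)" by simp
    have base2: "\<alpha> + 1 + of_nat (Suc N + j) = of_nat N + 1 + (\<alpha> + 1) + of_nat j"
      by (simp add: algebra_simps)
    \<comment> \<open>Both normalizing denominators become the same expression, so they are compared
      without being cancelled.\<close>
    have base3: "\<alpha> + \<beta> + of_nat (m + Suc N) + of_nat (Suc N + j) + 1 =
        of_nat m + (of_nat N + 1) + (\<beta> + of_nat N + 1) + 1 + (\<alpha> + 1) - 1 + of_nat j"
      by (simp add: algebra_simps)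
    have "of_nat N + 1 + 1 + of_nat j = (of_nat (Suc (Suc N + j)) :: complex)"
      by (simp add: algebra_simps)
    with pochhammer_of_nat_Suc_eq_fact_quotient[of "Suc N + j" "m + Suc N", where 'a = complex] that len
    have quot: "pochhammer (of_nat N + 1 + 1 + of_nat j) (m - j) =
        (fact (m + Suc N) / fact (Suc N + j) :: complex)"
      by (metis add.commute add_le_cancel_left)
    have sign: "(-1) ^ Suc N * (-1) ^ Suc N = (1 :: complex)"
      by (simp flip: power_mult_distrib)
    \<comment> \<open>Opaque names keep the simplifier from unfolding these factorials and the power
      of -1.\<close>
    define F where "F = (fact (m + Suc N) :: complex)"
    define G where "G = (fact (Suc N + j) :: complex)"
    define s where "s = ((-1) ^ Suc N :: complex)"
    \<comment> \<open>The factorials combine as (F/m!) (m!/j!) / G = (F/G) / j!, where F/G is the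
      factor (a+c+j)_{m-j} of \<open>g j\<close>. Each of the two reversals contributes one sign
      \<open>s\<close>.\<close>
    have "f (Suc N + j) = (s * s) * pochhammer (x - of_nat N) (Suc N) * g j"
      unfolding f_def g_def len base1 base2 base3 quot pochhammer_uminus_of_nat_shift
        pochhammer_minus_Suc_shift[of x] pochhammer_of_nat_Suc_eq_fact_quotient[OF that]
        F_def[symmetric] G_def[symmetric] s_def[symmetric]
      by (simp add: field_simps)
    then show ?thesis by (simp only: s_def sign mult_1)
  qed
  have "monic_hahn (m + Suc N) \<alpha> \<beta> N x = (\<Sum>k\<in>{0..m + Suc N}. f k)"
    unfolding monic_hahn_def f_def by simp
  also have "\<dots> = (\<Sum>k\<in>{0 + Suc N..m + Suc N}. f k)"
    by (rule sum.mono_neutral_right) (auto intro!: f_zero)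
  also have "\<dots> = (\<Sum>j=0..m. f (Suc N + j))"
    by (simp only: sum.shift_bounds_cl_nat_ivl add.commute)
  also have "\<dots> = pochhammer (x - of_nat N) (Suc N) * (\<Sum>j=0..m. g j)"
    unfolding sum_distrib_left by (intro sum.cong) (auto simp only: f_shift atLeastAtMost_iff)
  \<comment> \<open>Inserts (-i)^m i^m = 1; the second power belongs to the monic normalization of
    p_m.\<close>
  also have "\<dots> = pochhammer (x - of_nat N) (Suc N) * (- \<i>) ^ m * (\<i> ^ m * (\<Sum>j=0..m. g j))"
    by (simp flip: power_mult_distrib add: mult.assoc)
  also have "\<i> ^ m * (\<Sum>j=0..m. g j) =
      monic_continuous_hahn m (\<i> * x) (of_nat N + 1) (\<beta> + of_nat N + 1) 1 (\<alpha> + 1)"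
  proof -
    have "of_nat N + 1 + \<i> * (\<i> * x) = of_nat N + 1 - x"
      by (simp flip: mult.assoc)
    then show ?thesis unfolding monic_continuous_hahn_def g_def by simp
  qed
  finally show ?thesis .
qed

lemma monic_continuous_hahn_cong:
  assumes "a + \<i> * x = a' + \<i> * x'" "a + c = a' + c'" "a + d = a' + d'"
    and "a + b + c + d = a' + b' + c' + d'"
  shows "monic_continuous_hahn m x a b c d = monic_continuous_hahn m x' a' b' c' d'"
proof -
  \<comment> \<open>The denominator's sum nests to the left from \<open>of_nat m\<close>, so
    \<open>a + b + c + d\<close> is not a subterm of it.\<close>
  have "of_nat m + a + b + c + d = of_nat m + a' + b' + c' + d'"
    using assms(4) by (simp add: add.assoc)
  then show ?thesis unfolding monic_continuous_hahn_def by (simp only: assms(1-3))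
qed

theorem proposition3:
  fixes N n :: nat and \<alpha> \<beta> x :: complex
  assumes "n \<ge> N + 1"
    and "pochhammer (\<alpha> + \<beta> + of_nat n + 1) n \<noteq> 0"
  shows "monic_hahn n \<alpha> \<beta> N x =
           pochhammer (x - of_nat N) (N + 1) * (- \<i>) ^ (n - N - 1)
           * monic_continuous_hahn (n - N - 1) (\<i> * x)
               (of_nat N + 1) (\<beta> + of_nat N + 1) 1 (\<alpha> + 1)
       \<and> pochhammer (x - of_nat N) (N + 1) * (- \<i>) ^ (n - N - 1)
           * monic_continuous_hahn (n - N - 1) (\<i> * x)
               (of_nat N + 1) (\<beta> + of_nat N + 1) 1 (\<alpha> + 1) =
         pochhammer (x - of_nat N) (N + 1) * (- \<i>) ^ (n - N - 1)
           * monic_continuous_hahn (n - N - 1) ((x - of_nat N / 2) * \<i>)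
               (1 + of_nat N / 2) (\<beta> + 1 + of_nat N / 2)
               (1 + of_nat N / 2) (\<alpha> + 1 + of_nat N / 2)"
proof -
  \<comment> \<open>The bound on n makes the truncated subtraction exact.\<close>
  have n: "n - N - 1 + Suc N = n" using assms(1) by simp
  have "monic_hahn n \<alpha> \<beta> N x =
      pochhammer (x - of_nat N) (N + 1) * (- \<i>) ^ (n - N - 1)
      * monic_continuous_hahn (n - N - 1) (\<i> * x)
          (of_nat N + 1) (\<beta> + of_nat N + 1) 1 (\<alpha> + 1)"
    using monic_hahn_eq_monic_continuous_hahn[of "n - N - 1" N \<alpha> \<beta> x]
    by (simp only: n) simp
  moreover have "monic_continuous_hahn (n - N - 1) (\<i> * x)
        (of_nat N + 1) (\<beta> + of_nat N + 1) 1 (\<alpha> + 1) =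
      monic_continuous_hahn (n - N - 1) ((x - of_nat N / 2) * \<i>)
        (1 + of_nat N / 2) (\<beta> + 1 + of_nat N / 2)
        (1 + of_nat N / 2) (\<alpha> + 1 + of_nat N / 2)"
    \<comment> \<open>Moving N/2 from a and b to c and d preserves a+c, a+d and the total; shifting
      x by N/2 restores a+ix, as N+1-x = (1+N/2) - (x-N/2).\<close>
    by (rule monic_continuous_hahn_cong) (simp_all add: complex_eq_iff field_simps)
  ultimately show ?thesis by (simp only: simp_thms)
qed

end
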